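(* Let $(X,\alpha,\leq,\wedge,\vee)$ be a $\mathbb Z_2$-decreasing lattice that is locally convex with respect to $\leq$, and let $q:X\times X\to X$ be a Babylonian mean. Then the common limit $$p(x,y):=\lim_{n\to\infty}a_n(x,y)=\lim_{n\to\infty}h_n(x,y),$$ where $(a_n)$ and $(h_n)$ are the sequences of maps associated with $q$, defines a $\mathbb Z_2$-equivariant mean $p:X\times X\to X$. Additionally, if $X$ is an AR (respectively, an AE), then $(X,\alpha)$ is a $\mathbb Z_2$-AR (respectively, a $\mathbb Z_2$-AE).
   Context: All spaces are Hausdorff. An involution on a space $X$ is a continuous map $\alpha:X\to X$ with $\alpha\circ\alpha=1_X$; it corresponds to an action of $\mathbb Z_2=\{-1,1\}$ with $-1\cdot x=\alpha(x)$, and $(X,\alpha)$ denotes this $\mathbb Z_2$-space. A subset $A$ is invariant if $\alpha(A)=A$; a function $f:(X,\alpha)\to(Y,\beta)$ is equivariant if $f\circ\alpha=\beta\circ f$. A topological lattice is a Hausdorff space $X$ with a lattice structure $(X,\leq,\wedge,\vee)$ such that $\wedge,\vee:X\times X\to X$ are continuous. A $\mathbb Z_2$-decreasing lattice $(X,\alpha,\leq,\wedge,\vee)$ is a topological lattice with an involution $\alpha:X\to X$ such that $x\leq y$ implies $\alpha(y)\leq\alpha(x)$. For $x\le y$, $[x;y]=\{a\in X:x\leq a\leq y\}$; $A\subseteq X$ is convex with respect to $\leq$ if $[x;y]\subseteq A$ whenever $x,y\in A$ and $x\leq y$; $X$ is locally convex with respect to $\leq$ if its topology has a basis of sets convex with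 respect to $\leq$. A mean on $X$ is a continuous map $q:X\times X\to X$ with $q(x,x)=x$ and $q(x,y)=q(y,x)$ for all $x,y\in X$. It is equivariant if $q(\alpha(x),\alpha(y))=\alpha(q(x,y))$ for all $x,y$. For a mean $q$, put $q^\alpha(x,y):=\alpha(q(\alpha(x),\alpha(y)))$. The sequences of maps $a_n,h_n:X\times X\to X$ $(n\ge 0)$ associated with $q$ are defined by $a_0(x,y)=x$, $h_0(x,y)=y$, $a_{n+1}(x,y)=q(a_n(x,y),h_n(x,y))$, $h_{n+1}(x,y)=q^\alpha(a_n(x,y),h_n(x,y))$. The mean $q$ is Babylonian if one of the sequences $(a_n)_{n\geq1}$, $(h_n)_{n\geq1}$ is monotonically increasing with respect to the pointwise order and the other is monotonically decreasing, and for every $x,y\in X$ the sequences $(a_n(x,y))$ and $(h_n(x,y))$ converge and have the same limit. A $\mathbb Z_2$-space $Y$ is a $\mathbb Z_2$-AE if for every metrizable $\mathbb Z_2$-space $Z$, every closed invariant $A\subseteq Z$ and every continuous equivariant $f:A\to Y$ there is a continuous equivariant $F:Z\to Y$ with $F|_A=f$. A metrizable $\mathbb Z_2$-space $Y$ is a $\mathbb Z_2$-AR if for every metrizable $\mathbb Z_2$-space $Z$ containing $Y$ as a closed invariant subset there is a continuous equivariant retraction $Z\to Y$. AE and AR are the same notions without group action; in particular an AR is metrizable. *)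

theory Defs
  imports "HOL-Analysis.Analysis"
begin

subsection \<open>Spaces with involution, extensors and retracts\<close>

definition Z2_space :: "'a topology \<Rightarrow> ('a \<Rightarrow> 'a) \<Rightarrow> bool" where
  "Z2_space X \<alpha> \<longleftrightarrow>
     Hausdorff_space X \<and> continuous_map X X \<alpha> \<and> (\<forall>x\<in>topspace X. \<alpha> (\<alpha> x) = x)"

definition equivariant_on :: "'a set \<Rightarrow> ('a \<Rightarrow> 'a) \<Rightarrow> ('b \<Rightarrow> 'b) \<Rightarrow> ('a \<Rightarrow> 'b) \<Rightarrow> bool" where
  "equivariant_on A \<alpha> \<beta> f \<longleftrightarrow> (\<forall>x\<in>A. f (\<alpha> x) = \<beta> (f x))"

text \<open>
  HOL cannot quantify over all spaces inside a formula, so each of the four notions below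
  carries the type of the points of the test spaces \<open>Z\<close> as an argument.  Being an extensor or a
  retract in the usual sense means that the predicate holds for every type \<open>'z\<close>.
\<close>

definition absolute_extensor :: "'z itself \<Rightarrow> 'y topology \<Rightarrow> bool" where
  "absolute_extensor _ Y \<longleftrightarrow>
     Hausdorff_space Y \<and>
     (\<forall>(Z :: 'z topology) A f.
        metrizable_space Z \<and> closedin Z A \<and> continuous_map (subtopology Z A) Y f
        \<longrightarrow> (\<exists>F. continuous_map Z Y F \<and> (\<forall>z\<in>A. F z = f z)))"

definition Z2_absolute_extensor :: "'z itself \<Rightarrow> 'y topology \<Rightarrow> ('y \<Rightarrow> 'y) \<Rightarrow> bool" where
  "Z2_absolute_extensor _ Y \<beta> \<longleftrightarrow>
     Z2_space Y \<beta> \<and>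
     (\<forall>(Z :: 'z topology) \<gamma> A f.
        metrizable_space Z \<and> Z2_space Z \<gamma> \<and> closedin Z A \<and> \<gamma> ` A = A \<and>
        continuous_map (subtopology Z A) Y f \<and> equivariant_on A \<gamma> \<beta> f
        \<longrightarrow> (\<exists>F. continuous_map Z Y F \<and> equivariant_on (topspace Z) \<gamma> \<beta> F \<and>
                 (\<forall>z\<in>A. F z = f z)))"

text \<open>
  That \<open>Z\<close> contains \<open>Y\<close> as a closed (invariant) subset is expressed by an (equivariant)
  embedding with closed image.  Equivariance of the embedding makes the image invariant.
\<close>

definition absolute_retract :: "'z itself \<Rightarrow> 'y topology \<Rightarrow> bool" where
  "absolute_retract _ Y \<longleftrightarrow>
     metrizable_space Y \<and>
     (\<forall>(Z :: 'z topology) e.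
        metrizable_space Z \<and> embedding_map Y Z e \<and> closedin Z (e ` topspace Y)
        \<longrightarrow> e ` topspace Y retract_of_space Z)"

definition Z2_absolute_retract :: "'z itself \<Rightarrow> 'y topology \<Rightarrow> ('y \<Rightarrow> 'y) \<Rightarrow> bool" where
  "Z2_absolute_retract _ Y \<beta> \<longleftrightarrow>
     metrizable_space Y \<and> Z2_space Y \<beta> \<and>
     (\<forall>(Z :: 'z topology) \<gamma> e.
        metrizable_space Z \<and> Z2_space Z \<gamma> \<and>
        embedding_map Y Z e \<and> closedin Z (e ` topspace Y) \<and>
        equivariant_on (topspace Y) \<beta> \<gamma> e
        \<longrightarrow> (\<exists>r. continuous_map Z (subtopology Z (e ` topspace Y)) r \<and>
                 equivariant_on (topspace Z) \<gamma> \<gamma> r \<and>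
                 (\<forall>z\<in>e ` topspace Y. r z = z)))"

subsection \<open>Topological lattices with a decreasing involution\<close>

text \<open>
  The sort \<open>{t2_space, lattice}\<close> only says that the type carries a Hausdorff topology and a
  lattice order; it does not relate the two.
\<close>

definition topological_lattice :: "'a::{t2_space,lattice} itself \<Rightarrow> bool" where
  "topological_lattice _ \<longleftrightarrow>
     continuous_on UNIV (\<lambda>(x :: 'a, y). inf x y) \<and> continuous_on UNIV (\<lambda>(x :: 'a, y). sup x y)"

definition Z2_decreasing_lattice :: "('a::{t2_space,lattice} \<Rightarrow> 'a) \<Rightarrow> bool" where
  "Z2_decreasing_lattice \<alpha> \<longleftrightarrow>
     topological_lattice TYPE('a) \<and> Z2_space euclidean \<alpha> \<and> antimono \<alpha>"

definition order_convex :: "'a::order set \<Rightarrow> bool" where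
  "order_convex A \<longleftrightarrow> (\<forall>x\<in>A. \<forall>y\<in>A. x \<le> y \<longrightarrow> {x..y} \<subseteq> A)"

definition locally_order_convex :: "'a::{topological_space,order} itself \<Rightarrow> bool" where
  "locally_order_convex _ \<longleftrightarrow>
     (\<exists>B :: 'a set set. topological_basis B \<and> (\<forall>U\<in>B. order_convex U))"

subsection \<open>Babylonian means\<close>

definition is_mean :: "('a::topological_space \<Rightarrow> 'a \<Rightarrow> 'a) \<Rightarrow> bool" where
  "is_mean q \<longleftrightarrow>
     continuous_on UNIV (\<lambda>(x, y). q x y) \<and> (\<forall>x. q x x = x) \<and> (\<forall>x y. q x y = q y x)"

definition equivariant_mean :: "('a::topological_space \<Rightarrow> 'a) \<Rightarrow> ('a \<Rightarrow> 'a \<Rightarrow> 'a) \<Rightarrow> bool" where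
  "equivariant_mean \<alpha> q \<longleftrightarrow> is_mean q \<and> (\<forall>x y. q (\<alpha> x) (\<alpha> y) = \<alpha> (q x y))"

definition conj_mean :: "('a \<Rightarrow> 'a) \<Rightarrow> ('a \<Rightarrow> 'a \<Rightarrow> 'a) \<Rightarrow> 'a \<Rightarrow> 'a \<Rightarrow> 'a" where
  "conj_mean \<alpha> q x y = \<alpha> (q (\<alpha> x) (\<alpha> y))"

fun a_seq h_seq :: "('a \<Rightarrow> 'a) \<Rightarrow> ('a \<Rightarrow> 'a \<Rightarrow> 'a) \<Rightarrow> nat \<Rightarrow> 'a \<Rightarrow> 'a \<Rightarrow> 'a" where
  "a_seq \<alpha> q 0 x y = x"
| "h_seq \<alpha> q 0 x y = y"
| "a_seq \<alpha> q (Suc n) x y = q (a_seq \<alpha> q n x y) (h_seq \<alpha> q n x y)"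
| "h_seq \<alpha> q (Suc n) x y = conj_mean \<alpha> q (a_seq \<alpha> q n x y) (h_seq \<alpha> q n x y)"

text \<open>
  Monotonicity refers to the pointwise order on functions and, because of the \<open>Suc\<close>, to the
  sequences indexed by \<open>n \<ge> 1\<close>; the initial terms \<open>x\<close> and \<open>y\<close> need not be comparable.
\<close>

definition babylonian_mean ::
    "('a::{topological_space,order} \<Rightarrow> 'a) \<Rightarrow> ('a \<Rightarrow> 'a \<Rightarrow> 'a) \<Rightarrow> bool" where
  "babylonian_mean \<alpha> q \<longleftrightarrow>
     is_mean q \<and>
     (incseq (\<lambda>n. a_seq \<alpha> q (Suc n)) \<and> decseq (\<lambda>n. h_seq \<alpha> q (Suc n)) \<or>
      decseq (\<lambda>n. a_seq \<alpha> q (Suc n)) \<and> incseq (\<lambda>n. h_seq \<alpha> q (Suc n))) \<and>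
     (\<forall>x y. \<exists>l. (\<lambda>n. a_seq \<alpha> q n x y) \<longlonglongrightarrow> l \<and> (\<lambda>n. h_seq \<alpha> q n x y) \<longlonglongrightarrow> l)"

end

theory Submission
  imports Defs
begin

text \<open>
  The two sequences attached to a Babylonian mean are exchanged by the involution: since \<open>q\<^sup>\<alpha>\<close> is the
  conjugate of \<open>q\<close>, the terms at \<open>(\<alpha> x, \<alpha> y)\<close> of one sequence are the images under \<open>\<alpha>\<close> of the terms
  at \<open>(x, y)\<close> of the other (\<open>seq_conj\<close>).  As both have the same limit \<open>p(x, y)\<close>, the map \<open>p\<close> is
  equivariant; symmetry and idempotence pass to the limit as well.

  Continuity of \<open>p\<close> is a squeezing argument (\<open>continuous_on_squeeze\<close>).  The order of a topological
  lattice is closed, so \<open>p\<close> lies between the increasing and the decreasing sequence.  If \<open>U\<close> is a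
  convex neighbourhood of the limit at a point, then some pair of terms lies in \<open>U\<close> at that point,
  hence also nearby, and by convexity \<open>U\<close> then contains the limits at the nearby points.

  An equivariant mean turns an arbitrary map \<open>F\<close> between spaces with involution into an equivariant
  one, namely \<open>z \<mapsto> p (F z) (\<alpha> (F (\<gamma> z)))\<close>, the mean of \<open>F\<close> and its conjugate
  (\<open>symmetrization_equivariant\<close>).  Idempotence of \<open>p\<close> leaves \<open>F\<close> unchanged wherever it is equivariant
  already.  Symmetrizing an extension of an equivariant map therefore gives an equivariant extension,
  and symmetrizing a retraction gives an equivariant retraction.
\<close>

text \<open>
  Closedness of the order, in the form in which it is used: \<open>c \<le> X n\<close> says \<open>inf c (X n) = c\<close>, an
  equation that passes to limits because the space is Hausdorff.
\<close>

lemma topological_lattice_le_lim: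
  fixes X :: "nat \<Rightarrow> 'a::{t2_space,lattice}"
  assumes "topological_lattice TYPE('a)" and X: "X \<longlonglongrightarrow> l"
    and le: "eventually (\<lambda>n. c \<le> X n) sequentially"
  shows "c \<le> l"
proof -
  have "continuous_on UNIV (\<lambda>(x :: 'a, y). inf x y)"
    using assms(1) by (simp add: topological_lattice_def)
  from continuous_on_tendsto_compose[OF this tendsto_Pair[OF tendsto_const[of c] X]]
  have "(\<lambda>n. inf c (X n)) \<longlonglongrightarrow> inf c l"
    by simp
  moreover have "eventually (\<lambda>n. inf c (X n) = c) sequentially"
    using le by eventually_elim (simp add: inf_absorb1)
  then have "(\<lambda>n. inf c (X n)) \<longlonglongrightarrow> c"
    by (rule tendsto_eventually)
  ultimately have "inf c l = c"
    by (rule LIMSEQ_unique)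
  then show ?thesis
    by (simp add: le_iff_inf)
qed

lemma topological_lattice_lim_le:
  fixes X :: "nat \<Rightarrow> 'a::{t2_space,lattice}"
  assumes "topological_lattice TYPE('a)" and X: "X \<longlonglongrightarrow> l"
    and le: "eventually (\<lambda>n. X n \<le> c) sequentially"
  shows "l \<le> c"
proof -
  have "continuous_on UNIV (\<lambda>(x :: 'a, y). sup x y)"
    using assms(1) by (simp add: topological_lattice_def)
  from continuous_on_tendsto_compose[OF this tendsto_Pair[OF X tendsto_const[of c]]]
  have "(\<lambda>n. sup (X n) c) \<longlonglongrightarrow> sup l c"
    by simp
  moreover have "eventually (\<lambda>n. sup (X n) c = c) sequentially"
    using le by eventually_elim (simp add: sup_absorb2)
  then have "(\<lambda>n. sup (X n) c) \<longlonglongrightarrow> c"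
    by (rule tendsto_eventually)
  ultimately have "sup l c = c"
    by (rule LIMSEQ_unique)
  then show ?thesis
    by (simp add: le_iff_sup)
qed

text \<open>
  A lattice-valued analogue of Dini's theorem: on a convex neighbourhood, closeness of one lower and
  one upper bound controls the limit, so that pointwise convergence suffices for continuity.
\<close>

lemma continuous_on_squeeze:
  fixes l u :: "nat \<Rightarrow> 'b::topological_space \<Rightarrow> 'a::{t2_space,lattice}"
  assumes lat: "topological_lattice TYPE('a)" and conv: "locally_order_convex TYPE('a)"
    and cont: "\<And>n. continuous_on UNIV (l n)" "\<And>n. continuous_on UNIV (u n)"
    and mono: "incseq l" "decseq u"
    and lim: "\<And>z. (\<lambda>n. l n z) \<longlonglongrightarrow> p z" "\<And>z. (\<lambda>n. u n z) \<longlonglongrightarrow> p z"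
  shows "continuous_on UNIV p"
proof -
  have lp: "l n z \<le> p z" for n z
    by (intro topological_lattice_le_lim[OF lat lim(1)] eventually_sequentiallyI[of n]
        incseqD[OF mono(1), THEN le_funD])
  have pu: "p z \<le> u n z" for n z
    by (intro topological_lattice_lim_le[OF lat lim(2)] eventually_sequentiallyI[of n]
        decseqD[OF mono(2), THEN le_funD])
  obtain B :: "'a set set" where B: "topological_basis B" "\<And>U. U \<in> B \<Longrightarrow> order_convex U"
    using conv by (auto simp: locally_order_convex_def)
  have "\<exists>W. open W \<and> z \<in> W \<and> (\<forall>w\<in>W. p w \<in> V)" if V: "open V" "p z \<in> V" for z V
  proof -
    obtain U where U: "U \<in> B" "p z \<in> U" "U \<subseteq> V"
      using topological_basisE[OF B(1) V] by blast
    have "open U"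
      using B(1) U(1) by (rule topological_basis_open)
    then have "eventually (\<lambda>n. l n z \<in> U \<and> u n z \<in> U) sequentially"
      using U(2) lim[of z] by (intro eventually_conj topological_tendstoD)
    then obtain n where n: "l n z \<in> U" "u n z \<in> U"
      by (auto simp: eventually_sequentially)
    define W where "W = l n -` U \<inter> u n -` U"
    have "open W"
      unfolding W_def using \<open>open U\<close> cont[of n] by (intro open_Int open_vimage)
    moreover have "z \<in> W"
      using n by (simp add: W_def)
    moreover have "p w \<in> V" if "w \<in> W" for w
    proof -
      have "l n w \<in> U" "u n w \<in> U"
        using that by (simp_all add: W_def)
      moreover have "l n w \<le> u n w" "p w \<in> {l n w..u n w}"
        using lp[of n w] pu[of w n] by (auto intro: order_trans)
      ultimately have "p w \<in> U"
        using B(2)[OF U(1)] unfolding order_convex_def by blast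
      then show ?thesis
        using U(3) by blast
    qed
    ultimately show ?thesis
      by blast
  qed
  then show ?thesis
    unfolding continuous_on_topological by (metis UNIV_I)
qed

lemma continuous_on_seq:
  fixes q :: "'a::topological_space \<Rightarrow> 'a \<Rightarrow> 'a"
  assumes q: "continuous_on UNIV (\<lambda>(x, y). q x y)" and \<alpha>: "continuous_on UNIV \<alpha>"
  shows "continuous_on UNIV (\<lambda>(x, y). a_seq \<alpha> q n x y)
       \<and> continuous_on UNIV (\<lambda>(x, y). h_seq \<alpha> q n x y)"
proof (induction n)
  case 0
  then show ?case
    by (simp add: case_prod_unfold continuous_on_fst continuous_on_snd)
next
  case (Suc n)
  let ?a = "\<lambda>z. a_seq \<alpha> q n (fst z) (snd z)" and ?h = "\<lambda>z. h_seq \<alpha> q n (fst z) (snd z)"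
  have a: "continuous_on UNIV ?a" and h: "continuous_on UNIV ?h"
    using Suc.IH by (simp_all add: case_prod_unfold)
  have comp: "continuous_on UNIV (\<lambda>z. q (f z) (g z))"
    if "continuous_on UNIV f" "continuous_on UNIV g" for f g :: "'a \<times> 'a \<Rightarrow> 'a"
    using continuous_on_compose2[OF q continuous_on_Pair[OF that]] by simp
  have conj: "continuous_on UNIV (\<lambda>z. \<alpha> (f z))" if "continuous_on UNIV f" for f :: "'a \<times> 'a \<Rightarrow> 'a"
    using continuous_on_compose2[OF \<alpha> that] by simp
  show ?case
    using comp[OF a h] conj[OF comp[OF conj[OF a] conj[OF h]]]
    by (simp add: case_prod_unfold conj_mean_def)
qed

lemma seq_idem:
  assumes "is_mean q" and "\<And>x. \<alpha> (\<alpha> x) = x"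
  shows "a_seq \<alpha> q n x x = x \<and> h_seq \<alpha> q n x x = x"
  using assms by (induction n) (auto simp: is_mean_def conj_mean_def)

text \<open>
  The next two identities start at index one because the initial terms are the arguments themselves:
  \<open>a_seq \<alpha> q 0 x y = x\<close> depends on their order, and at \<open>(\<alpha> x, \<alpha> y)\<close> it is \<open>\<alpha> x\<close> and not the image
  \<open>\<alpha> y\<close> of the other initial term.  The first application of \<open>q\<close> makes the order irrelevant.
\<close>

lemma seq_commute:
  assumes "is_mean q"
  shows "a_seq \<alpha> q (Suc n) x y = a_seq \<alpha> q (Suc n) y x
       \<and> h_seq \<alpha> q (Suc n) x y = h_seq \<alpha> q (Suc n) y x"
proof (induction n)
  case 0
  then show ?case
    using assms by (simp add: is_mean_def conj_mean_def)
next
  case (Suc n)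
  then show ?case
    by (metis a_seq.simps(2) h_seq.simps(2))
qed

lemma seq_conj:
  assumes "is_mean q" and inv: "\<And>x. \<alpha> (\<alpha> x) = x"
  shows "a_seq \<alpha> q (Suc n) (\<alpha> x) (\<alpha> y) = \<alpha> (h_seq \<alpha> q (Suc n) x y)
       \<and> h_seq \<alpha> q (Suc n) (\<alpha> x) (\<alpha> y) = \<alpha> (a_seq \<alpha> q (Suc n) x y)"
proof (induction n)
  case 0
  then show ?case
    by (simp add: conj_mean_def inv)
next
  case (Suc n)
  have comm: "q u v = q v u" for u v
    using assms(1) by (simp add: is_mean_def)
  show ?case
    unfolding a_seq.simps(2)[of \<alpha> q "Suc n"] h_seq.simps(2)[of \<alpha> q "Suc n"]
    using Suc.IH by (simp only: conj_mean_def inv comm simp_thms)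
qed

lemma babylonian_limit_equivariant_mean:
  fixes \<alpha> :: "'a::{t2_space,lattice} \<Rightarrow> 'a"
  assumes lat: "Z2_decreasing_lattice \<alpha>"
    and conv: "locally_order_convex TYPE('a)"
    and bab: "babylonian_mean \<alpha> q"
    and lim: "\<And>x y. (\<lambda>n. a_seq \<alpha> q n x y) \<longlonglongrightarrow> p x y" "\<And>x y. (\<lambda>n. h_seq \<alpha> q n x y) \<longlonglongrightarrow> p x y"
  shows "equivariant_mean \<alpha> p"
proof -
  have top: "topological_lattice TYPE('a)"
    and \<alpha>: "continuous_on UNIV \<alpha>" and inv: "\<And>x. \<alpha> (\<alpha> x) = x"
    using lat by (simp_all add: Z2_decreasing_lattice_def Z2_space_def)
  have q: "is_mean q"
    using bab by (simp add: babylonian_mean_def)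
  note lim_Suc = lim[THEN LIMSEQ_Suc]
  have "continuous_on UNIV (\<lambda>(x, y). p x y)"
  proof -
    let ?a = "\<lambda>n (x, y). a_seq \<alpha> q (Suc n) x y" and ?h = "\<lambda>n (x, y). h_seq \<alpha> q (Suc n) x y"
    have cont: "continuous_on UNIV (?a n)" "continuous_on UNIV (?h n)" for n
      using q continuous_on_seq[of q \<alpha> "Suc n"] \<alpha> by (auto simp: is_mean_def)
    have lims: "(\<lambda>n. ?a n z) \<longlonglongrightarrow> (case z of (x, y) \<Rightarrow> p x y)"
      "(\<lambda>n. ?h n z) \<longlonglongrightarrow> (case z of (x, y) \<Rightarrow> p x y)" for z
      using lim_Suc by (simp_all only: case_prod_unfold)
    from bab have "incseq ?a \<and> decseq ?h \<or> decseq ?a \<and> incseq ?h"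
      unfolding babylonian_mean_def
      by (elim conjE disjE; simp only: monotone_def le_fun_def split_paired_All prod.case; blast)
    then show ?thesis
    proof (elim disjE conjE)
      assume "incseq ?a" "decseq ?h"
      from continuous_on_squeeze[OF top conv cont this lims] show ?thesis .
    next
      assume "decseq ?a" "incseq ?h"
      from continuous_on_squeeze[OF top conv cont(2,1) this(2,1) lims(2,1)] show ?thesis .
    qed
  qed
  moreover have "p x x = x" for x
    using lim(1)[of x x] seq_idem[OF q inv] by (simp add: LIMSEQ_const_iff)
  moreover have "p x y = p y x" for x y
    using lim_Suc(1)[of x y] lim_Suc(1)[of y x] seq_commute[OF q, of \<alpha> _ x y]
    by (metis (no_types, lifting) LIMSEQ_unique ext)
  moreover have "p (\<alpha> x) (\<alpha> y) = \<alpha> (p x y)" for x y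
  proof -
    have "(\<lambda>n. \<alpha> (h_seq \<alpha> q (Suc n) x y)) \<longlonglongrightarrow> \<alpha> (p x y)"
      by (rule continuous_on_tendsto_compose[OF \<alpha> lim_Suc(2)]) auto
    moreover have "(\<lambda>n. \<alpha> (h_seq \<alpha> q (Suc n) x y)) \<longlonglongrightarrow> p (\<alpha> x) (\<alpha> y)"
      using lim_Suc(1)[of "\<alpha> x" "\<alpha> y"] seq_conj[where \<alpha> = \<alpha>, OF q inv]
      by (simp only:)
    ultimately show ?thesis
      by (rule LIMSEQ_unique[symmetric])
  qed
  ultimately show ?thesis
    by (simp add: equivariant_mean_def is_mean_def)
qed

definition symmetrization ::
    "('a \<Rightarrow> 'a \<Rightarrow> 'a) \<Rightarrow> ('z \<Rightarrow> 'z) \<Rightarrow> ('a \<Rightarrow> 'a) \<Rightarrow> ('z \<Rightarrow> 'a) \<Rightarrow> 'z \<Rightarrow> 'a" where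
  "symmetrization p \<gamma> \<alpha> F z = p (F z) (\<alpha> (F (\<gamma> z)))"

lemma continuous_map_symmetrization:
  fixes \<alpha> :: "'a::topological_space \<Rightarrow> 'a"
  assumes p: "equivariant_mean \<alpha> p" and \<alpha>: "continuous_map euclidean euclidean \<alpha>"
    and \<gamma>: "continuous_map Z Z \<gamma>" and F: "continuous_map Z euclidean F"
  shows "continuous_map Z euclidean (symmetrization p \<gamma> \<alpha> F)"
proof -
  have "continuous_map Z euclidean (\<lambda>z. \<alpha> (F (\<gamma> z)))"
    using continuous_map_compose[OF continuous_map_compose[OF \<gamma> F] \<alpha>] by (simp add: o_def)
  with F have "continuous_map Z euclidean (\<lambda>z. (F z, \<alpha> (F (\<gamma> z))))"
    using continuous_map_pairedI[of Z euclidean F euclidean] by simp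
  moreover have "continuous_map euclidean euclidean (\<lambda>(x, y). p x y)"
    using p by (simp add: equivariant_mean_def is_mean_def)
  ultimately have "continuous_map Z euclidean ((\<lambda>(x, y). p x y) \<circ> (\<lambda>z. (F z, \<alpha> (F (\<gamma> z)))))"
    by (rule continuous_map_compose)
  then show ?thesis
    by (simp add: o_def symmetrization_def[abs_def])
qed

text \<open>
  Replacing \<open>z\<close> by \<open>\<gamma> z\<close> turns the two values being averaged into the images under \<open>\<alpha>\<close> of each
  other, and \<open>p\<close> is both equivariant and symmetric.
\<close>

lemma symmetrization_equivariant:
  assumes p: "equivariant_mean \<alpha> p" and \<alpha>: "\<And>x. \<alpha> (\<alpha> x) = x" and \<gamma>: "\<And>z. z \<in> A \<Longrightarrow> \<gamma> (\<gamma> z) = z"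
  shows "equivariant_on A \<gamma> \<alpha> (symmetrization p \<gamma> \<alpha> F)"
  unfolding equivariant_on_def symmetrization_def
proof
  fix z assume "z \<in> A"
  have "p (F (\<gamma> z)) (\<alpha> (F (\<gamma> (\<gamma> z)))) = p (\<alpha> (F z)) (\<alpha> (\<alpha> (F (\<gamma> z))))"
    using p \<open>z \<in> A\<close> by (simp add: \<alpha> \<gamma> equivariant_mean_def is_mean_def)
  also have "\<dots> = \<alpha> (p (F z) (\<alpha> (F (\<gamma> z))))"
    using p unfolding equivariant_mean_def by blast
  finally show "p (F (\<gamma> z)) (\<alpha> (F (\<gamma> (\<gamma> z)))) = \<alpha> (p (F z) (\<alpha> (F (\<gamma> z))))" .
qed

lemma symmetrization_fixes_equivariant:
  assumes "equivariant_mean \<alpha> p" and "\<And>x. \<alpha> (\<alpha> x) = x" and "F (\<gamma> z) = \<alpha> (F z)"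
  shows "symmetrization p \<gamma> \<alpha> F z = F z"
  using assms by (simp add: symmetrization_def equivariant_mean_def is_mean_def)

lemma Z2_absolute_extensor_if_equivariant_mean:
  fixes \<alpha> :: "'a::topological_space \<Rightarrow> 'a"
  assumes Z2: "Z2_space euclidean \<alpha>" and p: "equivariant_mean \<alpha> p"
    and AE: "absolute_extensor TYPE('z) (euclidean :: 'a topology)"
  shows "Z2_absolute_extensor TYPE('z) euclidean \<alpha>"
  unfolding Z2_absolute_extensor_def
proof (intro conjI allI impI, fact Z2, elim conjE)
  fix Z :: "'z topology" and \<gamma> A and f :: "'z \<Rightarrow> 'a"
  assume Z: "metrizable_space Z" "Z2_space Z \<gamma>" and A: "closedin Z A" "\<gamma> ` A = A"
    and f: "continuous_map (subtopology Z A) euclidean f" "equivariant_on A \<gamma> \<alpha> f"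
  have \<alpha>: "continuous_map euclidean euclidean \<alpha>" "\<And>x. \<alpha> (\<alpha> x) = x"
    using Z2 by (auto simp: Z2_space_def)
  have \<gamma>: "continuous_map Z Z \<gamma>" "\<And>z. z \<in> topspace Z \<Longrightarrow> \<gamma> (\<gamma> z) = z"
    using Z(2) by (auto simp: Z2_space_def)
  obtain F where F: "continuous_map Z euclidean F" "\<And>z. z \<in> A \<Longrightarrow> F z = f z"
    using AE[unfolded absolute_extensor_def, THEN conjunct2, rule_format, of Z A f] Z(1) A(1) f(1)
    by blast
  show "\<exists>F. continuous_map Z euclidean F \<and> equivariant_on (topspace Z) \<gamma> \<alpha> F \<and> (\<forall>z\<in>A. F z = f z)"
  proof (intro exI conjI ballI)
    show "continuous_map Z euclidean (symmetrization p \<gamma> \<alpha> F)"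
      using p \<alpha>(1) \<gamma>(1) F(1) by (rule continuous_map_symmetrization)
    show "equivariant_on (topspace Z) \<gamma> \<alpha> (symmetrization p \<gamma> \<alpha> F)"
      using p \<alpha>(2) \<gamma>(2) by (rule symmetrization_equivariant)
    fix z assume "z \<in> A"
    moreover have "\<gamma> z \<in> A"
      using A(2) \<open>z \<in> A\<close> by blast
    ultimately have "F (\<gamma> z) = \<alpha> (F z)"
      using F(2) f(2) by (simp add: equivariant_on_def)
    then show "symmetrization p \<gamma> \<alpha> F z = f z"
      using symmetrization_fixes_equivariant[OF p \<alpha>(2)] F(2) \<open>z \<in> A\<close> by metis
  qed
qed

text \<open>
  Only a map into the lattice can be symmetrized, so a retraction of \<open>Z\<close> onto the embedded copy of
  the lattice is first composed with the inverse \<open>g\<close> of the embedding.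
\<close>

lemma Z2_absolute_retract_if_equivariant_mean:
  fixes \<alpha> :: "'a::topological_space \<Rightarrow> 'a"
  assumes Z2: "Z2_space euclidean \<alpha>" and p: "equivariant_mean \<alpha> p"
    and AR: "absolute_retract TYPE('z) (euclidean :: 'a topology)"
  shows "Z2_absolute_retract TYPE('z) euclidean \<alpha>"
  unfolding Z2_absolute_retract_def
proof (intro conjI allI impI)
  show "metrizable_space (euclidean :: 'a topology)"
    using AR by (simp add: absolute_retract_def)
  show "Z2_space euclidean \<alpha>" by fact
next
  fix Z :: "'z topology" and \<gamma> and e :: "'a \<Rightarrow> 'z"
  let ?E = "e ` topspace euclidean"
  assume "metrizable_space Z \<and> Z2_space Z \<gamma> \<and> embedding_map euclidean Z e \<and>
    closedin Z ?E \<and> equivariant_on (topspace euclidean) \<alpha> \<gamma> e"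
  then have Z: "metrizable_space Z" "Z2_space Z \<gamma>" and e: "embedding_map euclidean Z e"
    and cl: "closedin Z ?E" and e_eq: "\<And>x. e (\<alpha> x) = \<gamma> (e x)"
    by (auto simp: equivariant_on_def)
  have \<alpha>: "continuous_map euclidean euclidean \<alpha>" "\<And>x. \<alpha> (\<alpha> x) = x"
    using Z2 by (auto simp: Z2_space_def)
  have \<gamma>: "continuous_map Z Z \<gamma>" "\<And>z. z \<in> topspace Z \<Longrightarrow> \<gamma> (\<gamma> z) = z"
    using Z(2) by (auto simp: Z2_space_def)
  obtain r where r: "continuous_map Z (subtopology Z ?E) r" "\<And>z. z \<in> ?E \<Longrightarrow> r z = z"
    using AR[unfolded absolute_retract_def, THEN conjunct2, rule_format, of Z e] Z(1) e cl
    unfolding retract_of_space_def by blast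
  obtain g where g: "homeomorphic_maps euclidean (subtopology Z ?E) e g"
    using e unfolding embedding_map_def homeomorphic_map_maps by blast
  then have e_cont: "continuous_map euclidean (subtopology Z ?E) e"
    and g_cont: "continuous_map (subtopology Z ?E) euclidean g" and ge: "\<And>x. g (e x) = x"
    by (auto simp: homeomorphic_maps_def)
  define F where "F = g \<circ> r"
  have F: "continuous_map Z euclidean F"
    unfolding F_def using r(1) g_cont by (rule continuous_map_compose)
  have Fe: "F (e x) = x" for x
    by (simp add: F_def r(2) ge)
  let ?G = "symmetrization p \<gamma> \<alpha> F"
  show "\<exists>r. continuous_map Z (subtopology Z ?E) r \<and> equivariant_on (topspace Z) \<gamma> \<gamma> r \<and>
    (\<forall>z\<in>?E. r z = z)"
  proof (intro exI conjI ballI)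
    show "continuous_map Z (subtopology Z ?E) (e \<circ> ?G)"
      using continuous_map_symmetrization[OF p \<alpha>(1) \<gamma>(1) F] e_cont
      by (rule continuous_map_compose)
    have "equivariant_on (topspace Z) \<gamma> \<alpha> ?G"
      using p \<alpha>(2) \<gamma>(2) by (rule symmetrization_equivariant)
    then show "equivariant_on (topspace Z) \<gamma> \<gamma> (e \<circ> ?G)"
      by (simp add: equivariant_on_def e_eq)
    fix z assume "z \<in> ?E"
    then obtain x where z: "z = e x"
      by blast
    have "F (\<gamma> z) = \<alpha> (F z)"
      by (simp add: z Fe flip: e_eq)
    then show "(e \<circ> ?G) z = z"
      using symmetrization_fixes_equivariant[OF p \<alpha>(2)] by (metis Fe comp_apply z)
  qed
qed

theorem theorem4p11:
  fixes \<alpha> :: "'a::{t2_space,lattice} \<Rightarrow> 'a"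
    and q :: "'a \<Rightarrow> 'a \<Rightarrow> 'a"
  assumes "Z2_decreasing_lattice \<alpha>"
    and "locally_order_convex TYPE('a)"
    and "babylonian_mean \<alpha> q"
  shows "(\<exists>p. (\<forall>x y. (\<lambda>n. a_seq \<alpha> q n x y) \<longlonglongrightarrow> p x y \<and> (\<lambda>n. h_seq \<alpha> q n x y) \<longlonglongrightarrow> p x y)
              \<and> equivariant_mean \<alpha> p)
       \<and> (absolute_retract TYPE('z) (euclidean :: 'a topology)
            \<longrightarrow> Z2_absolute_retract TYPE('z) euclidean \<alpha>)
       \<and> (absolute_extensor TYPE('z) (euclidean :: 'a topology)
            \<longrightarrow> Z2_absolute_extensor TYPE('z) euclidean \<alpha>)"
proof -
  have Z2: "Z2_space euclidean \<alpha>"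
    using assms(1) by (simp add: Z2_decreasing_lattice_def)
  obtain p where lim: "\<And>x y. (\<lambda>n. a_seq \<alpha> q n x y) \<longlonglongrightarrow> p x y"
      "\<And>x y. (\<lambda>n. h_seq \<alpha> q n x y) \<longlonglongrightarrow> p x y"
    using assms(3) unfolding babylonian_mean_def by metis
  have p: "equivariant_mean \<alpha> p"
    using assms lim by (rule babylonian_limit_equivariant_mean)
  show ?thesis
    using lim p Z2_absolute_retract_if_equivariant_mean[OF Z2 p]
      Z2_absolute_extensor_if_equivariant_mean[OF Z2 p] by blast
qed

end
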